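(* Consider a Borel probability measure $\mu$ on $\mathbb T$ having nonzero first moment, and let $t>1$ be a real number. Assume that the function $\eta_\mu$ never vanishes on $\mathbb D\setminus\{0\}$. Then, for suitable choices of analytic branches of the powers involved: (1) There exists a probability measure $\mu_t$ on $\mathbb T$ such that $\int_{\mathbb T}\zeta\,d\mu_t(\zeta)\neq0$ and $\Sigma_{\mu_t}(z)=\Sigma_\mu(z)^t$ in a neighborhood of zero. Moreover, $\eta_{\mu_t}$ never vanishes on $\mathbb D\setminus\{0\}$. (2) There exists an analytic function $\omega_t:\mathbb D\to\mathbb D$ such that $|\omega_t(z)|\le|z|$ and $\eta_{\mu_t}(z)=\eta_\mu(\omega_t(z))$ for $z\in\mathbb D$. (3) We have $$\omega_t(z)=\eta_{\mu_t}(z)\left[\frac z{\eta_{\mu_t}(z)}\right]^{1/t},\quad z\in\mathbb D,$$ and $\Phi_t(\omega_t(z))=z$ for $z\in\mathbb D$, where $$\Phi_t(z)=z\left[\frac z{\eta_\mu(z)}\right]^{t-1},\quad z\in\mathbb D.$$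
   Context: $\mathbb D$ is the open unit disk, $\mathbb T$ the unit circle. For a Borel probability measure $\mu$ on $\mathbb T$ let $\psi_\mu(z)=\int_{\mathbb T}\frac{z\zeta}{1-z\zeta}\,d\mu(\zeta)$ and $\eta_\mu(z)=\frac{\psi_\mu(z)}{1+\psi_\mu(z)}$, $z\in\mathbb D$; then $\eta_\mu(0)=0$, $|\eta_\mu(z)|\le|z|$ and $\eta_\mu'(0)=\int_{\mathbb T}\zeta\,d\mu(\zeta)$. If $\eta_\mu'(0)\ne0$, $\eta_\mu$ has an analytic inverse $\eta_\mu^{-1}$ in a neighborhood of $0$ and $\Sigma_\mu(z)=\eta_\mu^{-1}(z)/z$ there (removable singularity at $0$ filled in). When $\eta_\mu$ has no zero in $\mathbb D\setminus\{0\}$ and $\eta_\mu'(0)\ne0$, the function $z/\eta_\mu(z)$ is analytic and zero-free on $\mathbb D$, so its real powers have analytic branches on $\mathbb D$; the powers in the statement are analytic branches, chosen consistently, and $\mu_t$ depends on that choice (it is determined only up to a rotation). The same $\mu_t$ and $\omega_t$ appear in (1)-(3). *)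

theory Defs
  imports "HOL-Probability.Probability" "HOL-Complex_Analysis.Complex_Analysis"
begin

definition prob_on_circle :: "complex measure \<Rightarrow> bool" where
  "prob_on_circle M \<longleftrightarrow> prob_space M \<and> sets M = sets (restrict_space borel (sphere 0 1))"

definition psi :: "complex measure \<Rightarrow> complex \<Rightarrow> complex" where
  "psi M z = (\<integral>w. z * w / (1 - z * w) \<partial>M)"

definition eta :: "complex measure \<Rightarrow> complex \<Rightarrow> complex" where
  "eta M z = psi M z / (1 + psi M z)"

definition first_moment :: "complex measure \<Rightarrow> complex" where
  "first_moment M = (\<integral>w. w \<partial>M)"

definition eta_zero_free :: "complex measure \<Rightarrow> bool" where
  "eta_zero_free M \<longleftrightarrow> (\<forall>z\<in>ball 0 1 - {0}. eta M z \<noteq> 0)"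

(* A representative of the germ at 0 of the analytic inverse of eta. It exists when the first
   moment is nonzero; the germ is unique, the values away from 0 are unspecified. Only values
   in a sufficiently small neighbourhood of 0 may be used. *)
definition eta_inv :: "complex measure \<Rightarrow> complex \<Rightarrow> complex" where
  "eta_inv M = (SOME g. g analytic_on {0} \<and> g 0 = 0 \<and>
      (\<forall>\<^sub>F z in nhds 0. eta M (g z) = z) \<and> (\<forall>\<^sub>F z in nhds 0. g (eta M z) = z))"

(* Like eta_inv, meaningful only as a germ at 0. *)
definition Sigma_transform :: "complex measure \<Rightarrow> complex \<Rightarrow> complex" where
  "Sigma_transform M = remove_sings (\<lambda>z. eta_inv M z / z)"

(* z / eta M z, with the value 1 / eta'(0) at z = 0. *)
definition eta_quot :: "complex measure \<Rightarrow> complex \<Rightarrow> complex" where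
  "eta_quot M = remove_sings (\<lambda>z. z / eta M z)"

definition log_branch :: "complex set \<Rightarrow> (complex \<Rightarrow> complex) \<Rightarrow> (complex \<Rightarrow> complex) \<Rightarrow> bool" where
  "log_branch S f L \<longleftrightarrow> L holomorphic_on S \<and> (\<forall>z\<in>S. exp (L z) = f z)"

(* If L is an analytic logarithm of f, this is the corresponding analytic branch of f^a. *)
definition branch_power :: "(complex \<Rightarrow> complex) \<Rightarrow> real \<Rightarrow> complex \<Rightarrow> complex" where
  "branch_power L a z = exp (complex_of_real a * L z)"

(* Phi_t, the power of z / eta M z being taken along the logarithm L of eta_quot M. *)
definition Phi :: "(complex \<Rightarrow> complex) \<Rightarrow> real \<Rightarrow> complex \<Rightarrow> complex" where
  "Phi L t z = z * branch_power L (t - 1) z"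

end

theory Submission
  imports Defs
begin

text \<open>
  The holomorphic self-maps of the disc that vanish at 0 are exactly the functions \<open>eta \<nu>\<close>: one
  inclusion holds because \<open>Re (psi \<nu> z) > -1/2\<close>, the other is the Herglotz representation of
  \<open>(1 + f) / (1 - f)\<close>. Let \<open>L\<close> be a logarithm of \<open>z / eta M z\<close>. By the Schwarz lemma \<open>Re L \<ge> 0\<close>, so
  \<open>k = exp (-(t - 1) L)\<close> is bounded by 1 and the equation \<open>\<omega> z = z k(\<omega> z)\<close>, which says that
  \<open>Phi L t (\<omega> z) = z\<close>, has a holomorphic solution with \<open>|\<omega> z| \<le> |z|\<close>. Then \<open>eta M \<circ> \<omega>\<close> is the
  transform of a measure \<open>Mt\<close>, and everything else is algebra with the logarithms \<open>L\<close>,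
  \<open>Lt = t L \<circ> \<omega>\<close> and \<open>LS = L \<circ> eta_inv M\<close>.
\<close>

section \<open>The transform of a measure on the circle\<close>

lemma space_prob_on_circle:
  assumes "prob_on_circle M"
  shows "space M = sphere 0 1"
  using sets_eq_imp_space_eq[of M "restrict_space borel (sphere 0 1)"] assms
  by (simp add: prob_on_circle_def space_restrict_space)

lemma integrable_on_circle:
  fixes f :: "complex \<Rightarrow> complex"
  assumes M: "prob_on_circle M" and f: "continuous_on (sphere 0 1) f"
  shows "integrable M f"
proof -
  interpret prob_space M using M by (simp add: prob_on_circle_def)
  obtain B where "\<And>w. w \<in> sphere 0 1 \<Longrightarrow> norm (f w) \<le> B"
    using continuous_on_compact_bound[OF compact_sphere f] by blast
  moreover have "f \<in> borel_measurable M"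
    using borel_measurable_continuous_on_restrict[OF f] M
    by (simp add: prob_on_circle_def cong: measurable_cong_sets)
  ultimately show ?thesis
    by (intro integrable_const_bound[where B = B]) (auto simp: space_prob_on_circle[OF M])
qed

lemma one_minus_mult_nz:
  fixes z w :: complex
  assumes "norm z < 1" "norm w \<le> 1"
  shows "1 - z * w \<noteq> 0"
proof -
  have "norm (z * w) \<le> norm z * 1"
    unfolding norm_mult using assms by (intro mult_left_mono) auto
  then show ?thesis using assms(1) by auto
qed

text \<open>On the circle the geometric series of \<open>w / (1 - z * w)\<close> has terms of norm
  \<open>norm z ^ n\<close>, so it can be integrated termwise; \<open>G\<close> is the power series
  of the moments. Splitting off \<open>z\<close> gives access to the quotient by \<open>z\<close> at
  0 without any division there.\<close>

lemma psi_factor: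
  assumes M: "prob_on_circle M"
  obtains G where "G holomorphic_on ball 0 1" "G 0 = first_moment M"
    "\<And>z. norm z < 1 \<Longrightarrow> psi M z = z * G z"
proof
  interpret prob_space M using M by (simp add: prob_on_circle_def)
  let ?m = "\<lambda>n. \<integral>w. w ^ Suc n \<partial>M"
  let ?G = "\<lambda>z. \<integral>w. w / (1 - z * w) \<partial>M"
  note space = space_prob_on_circle[OF M]
  have sums: "(\<lambda>n. ?m n * (z - 0) ^ n) sums ?G z" if "z \<in> ball 0 1" for z
  proof -
    have z: "norm z < 1" using that by simp
    let ?f = "\<lambda>n w. z ^ n * w ^ Suc n"
    have norm_f: "norm (?f n w) = norm z ^ n" if "w \<in> space M" for n w
      using that by (simp add: space norm_mult norm_power)
    have "(\<lambda>n. \<integral>w. ?f n w \<partial>M) sums (\<integral>w. (\<Sum>n. ?f n w) \<partial>M)"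
    proof (rule sums_integral)
      show "integrable M (?f n)" for n
        by (intro integrable_on_circle[OF M] continuous_intros)
      show "AE w in M. summable (\<lambda>n. norm (?f n w))"
        using norm_f z by (intro AE_I2) (simp add: summable_geometric)
      have "(\<integral>w. norm (?f n w) \<partial>M) = norm z ^ n" for n
        using norm_f by (subst Bochner_Integration.integral_cong[OF refl norm_f]) (auto simp: prob_space)
      then show "summable (\<lambda>n. \<integral>w. norm (?f n w) \<partial>M)"
        using z by (simp add: summable_geometric)
    qed
    moreover have "(\<Sum>n. ?f n w) = w / (1 - z * w)" if "w \<in> space M" for w
    proof -
      have "norm (z * w) < 1" using that z by (simp add: space norm_mult)
      then have "(\<lambda>n. w * (z * w) ^ n) sums (w * (1 / (1 - z * w)))"
        by (intro sums_mult geometric_sums)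
      then show ?thesis
        by (simp add: sums_iff power_mult_distrib mult_ac)
    qed
    ultimately show ?thesis
      using Bochner_Integration.integral_cong[OF refl, of M "\<lambda>w. \<Sum>n. ?f n w" "\<lambda>w. w / (1 - z * w)"]
      by (simp add: mult.commute del: power_Suc)
  qed
  show "?G holomorphic_on ball 0 1"
    by (rule power_series_holomorphic[OF sums])
  show "?G 0 = first_moment M"
    by (simp add: first_moment_def)
  show "psi M z = z * ?G z" for z
    unfolding psi_def by (simp flip: integral_mult_right_zero)
qed

text \<open>Since \<open>u / (1 - u) = 1 / (1 - u) - 1\<close>, this reflects that
  \<open>1 / (1 - u)\<close> maps the disc into the half-plane of real part above 1/2. The bound
  \<open>1 / (1 + norm z) - 1\<close> is uniform in \<open>w\<close>, so strictness survives
  integration.\<close>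

lemma Re_psi_gt:
  assumes M: "prob_on_circle M" and z: "norm z < 1"
  shows "Re (psi M z) > - 1 / 2"
proof -
  interpret prob_space M using M by (simp add: prob_on_circle_def)
  note space = space_prob_on_circle[OF M]
  let ?\<rho> = "norm z"
  have lower: "Re (z * w / (1 - z * w)) \<ge> 1 / (1 + ?\<rho>) - 1" if "w \<in> space M" for w
  proof -
    define u where "u = z * w"
    have u: "norm u = ?\<rho>" using that by (simp add: u_def space norm_mult)
    have nz: "1 - u \<noteq> 0"
      using that z one_minus_mult_nz[of z w] by (simp add: u_def space)
    have "u / (1 - u) = 1 / (1 - u) - 1"
      using nz by (simp add: field_simps)
    moreover have "Re (1 / (1 - u)) = (1 - Re u) / (norm (1 - u))\<^sup>2"
      by (simp add: Re_divide cmod_power2)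
    moreover have "(norm (1 - u))\<^sup>2 = 1 - 2 * Re u + ?\<rho>\<^sup>2"
      unfolding u[symmetric] cmod_power2 by (simp add: power2_eq_square algebra_simps)
    moreover have "1 / (1 + ?\<rho>) \<le> (1 - Re u) / (1 - 2 * Re u + ?\<rho>\<^sup>2)"
    proof -
      \<comment> \<open>Cleared of denominators, the inequality says exactly that this product is
        nonnegative.\<close>
      have "(1 - ?\<rho>) * (?\<rho> + Re u) \<ge> 0"
        using abs_Re_le_cmod[of u] u z by (intro mult_nonneg_nonneg) auto
      moreover have "1 - 2 * Re u + ?\<rho>\<^sup>2 > 0"
        using nz \<open>(norm (1 - u))\<^sup>2 = _\<close> by (metis zero_less_norm_iff zero_less_power)
      moreover have "1 + ?\<rho> > 0" using norm_ge_zero[of z] by linarith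
      ultimately show ?thesis
        by (simp add: field_simps power2_eq_square)
    qed
    ultimately show ?thesis by (simp add: u_def)
  qed
  have int: "integrable M (\<lambda>w. z * w / (1 - z * w))"
    using one_minus_mult_nz[OF z]
    by (intro integrable_on_circle[OF M] continuous_intros) auto
  have "- 1 / 2 < 1 / (1 + ?\<rho>) - 1"
    using z by (simp add: field_simps add_pos_nonneg)
  also have "\<dots> = (\<integral>w. 1 / (1 + ?\<rho>) - 1 \<partial>M)"
    by (simp add: prob_space)
  also have "\<dots> \<le> (\<integral>w. Re (z * w / (1 - z * w)) \<partial>M)"
    using lower int by (intro integral_mono) auto
  also have "\<dots> = Re (psi M z)"
    unfolding psi_def using int by simp
  finally show ?thesis .
qed

section \<open>The map \<open>eta\<close> as a holomorphic self-map of the disc\<close>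

lemma eta_factor:
  assumes M: "prob_on_circle M"
  obtains H where "H holomorphic_on ball 0 1" "H 0 = first_moment M"
    "\<And>z. norm z < 1 \<Longrightarrow> eta M z = z * H z"
proof -
  obtain G where G: "G holomorphic_on ball 0 1" "G 0 = first_moment M"
    "\<And>z. norm z < 1 \<Longrightarrow> psi M z = z * G z"
    using psi_factor[OF M] by blast
  have nz: "1 + z * G z \<noteq> 0" if "norm z < 1" for z
  proof
    assume "1 + z * G z = 0"
    then have "psi M z = -1" using G(3)[OF that] by (simp add: add_eq_0_iff)
    then show False using Re_psi_gt[OF M that] by simp
  qed
  show ?thesis
  proof
    show "(\<lambda>z. G z / (1 + z * G z)) holomorphic_on ball 0 1"
      using nz by (intro holomorphic_intros G) auto
  qed (use G in \<open>auto simp: eta_def\<close>)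
qed

text \<open>The condition \<open>norm p < norm (1 + p)\<close> describes the half-plane to the right
  of -1/2.\<close>

lemma norm_eta_less_1:
  assumes M: "prob_on_circle M" and z: "norm z < 1"
  shows "norm (eta M z) < 1"
proof -
  let ?p = "psi M z"
  have "(norm ?p)\<^sup>2 < (norm (1 + ?p))\<^sup>2"
    using Re_psi_gt[OF assms] unfolding cmod_power2 by (simp add: power2_eq_square algebra_simps)
  then have *: "norm ?p < norm (1 + ?p)"
    by (rule power2_less_imp_less) simp
  then show ?thesis
    using divide_less_eq_1_pos[OF le_less_trans[OF norm_ge_zero *]] by (simp add: eta_def norm_divide)
qed

lemma eta_holomorphic:
  assumes "prob_on_circle M"
  shows "eta M holomorphic_on ball 0 1"
proof -
  obtain H where H: "H holomorphic_on ball 0 1" "\<And>z. norm z < 1 \<Longrightarrow> eta M z = z * H z"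
    using eta_factor[OF assms] by metis
  show ?thesis
    by (rule holomorphic_transform[of "\<lambda>z. z * H z"]) (auto intro!: holomorphic_intros H simp: H(2))
qed

lemma eta_0 [simp]: "eta M 0 = 0"
  by (simp add: eta_def psi_def)

lemma norm_eta_le:
  assumes "prob_on_circle M" "norm z < 1"
  shows "norm (eta M z) \<le> norm z"
  using Schwarz_Lemma(1)[OF eta_holomorphic[OF assms(1)] eta_0] norm_eta_less_1[OF assms(1)] assms(2)
  by blast

lemma eta_has_field_derivative_0:
  assumes J: "J holomorphic_on ball 0 1" "\<And>z. norm z < 1 \<Longrightarrow> eta M z = z * J z"
  shows "(eta M has_field_derivative J 0) (at 0)"
proof -
  have "(J has_field_derivative deriv J 0) (at 0)"
    using J(1) holomorphic_derivI[of J "ball 0 1" 0] by simp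
  then have "((\<lambda>z. z * J z) has_field_derivative J 0) (at 0)"
    by (auto intro!: derivative_eq_intros)
  then show ?thesis
    by (rule has_field_derivative_transform_within_open[of _ _ _ "ball 0 1"]) (auto simp: J(2))
qed

text \<open>Every factor \<open>J\<close> takes the derivative of \<open>eta M\<close> as its value
  at 0, so all factors agree there. This yields the first moment when only an explicit formula for
  \<open>eta M\<close> is known.\<close>

lemma first_moment_eq_factor:
  assumes M: "prob_on_circle M"
    and J: "J holomorphic_on ball 0 1" "\<And>z. norm z < 1 \<Longrightarrow> eta M z = z * J z"
  shows "first_moment M = J 0"
proof -
  obtain H where "H holomorphic_on ball 0 1" "H 0 = first_moment M"
    "\<And>z. norm z < 1 \<Longrightarrow> eta M z = z * H z"
    using eta_factor[OF M] by metis
  then show ?thesis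
    using eta_has_field_derivative_0 J DERIV_unique by metis
qed

lemma deriv_eta_0:
  assumes "prob_on_circle M"
  shows "deriv (eta M) 0 = first_moment M"
  using eta_factor[OF assms] eta_has_field_derivative_0 DERIV_imp_deriv by metis

text \<open>At 0 the factor is the derivative of \<open>eta M\<close>, which the Schwarz lemma
  bounds as well. For \<open>J = exp (- L)\<close> the bound says
  \<open>Re L \<ge> 0\<close>.\<close>

lemma norm_factor_le_1:
  assumes M: "prob_on_circle M"
    and J: "J holomorphic_on ball 0 1" "\<And>z. norm z < 1 \<Longrightarrow> eta M z = z * J z"
    and z: "norm z < 1"
  shows "norm (J z) \<le> 1"
proof (cases "z = 0")
  case True
  have "norm (deriv (eta M) 0) \<le> 1"
    using Schwarz_Lemma(2)[OF eta_holomorphic[OF M] eta_0 norm_eta_less_1[OF M], of 0] by simp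
  then show ?thesis
    using True deriv_eta_0[OF M] first_moment_eq_factor[OF M J] by simp
next
  case False
  have "norm z * norm (J z) \<le> norm z * 1"
    using norm_eta_le[OF M z] J(2)[OF z] by (simp add: norm_mult)
  then show ?thesis using False mult_le_cancel_left_pos[of "norm z" "norm (J z)" 1] by simp
qed

section \<open>Germs at the origin: removable singularities and the local inverse\<close>

text \<open>\<open>remove_sings g\<close> is a limit at every point, not just at the singularity.
  Near any \<open>z\<close> the functions \<open>g\<close> and \<open>f\<close> agree off
  \<open>z\<close> and \<open>a\<close>, which treats \<open>z = a\<close> and
  \<open>z \<noteq> a\<close> at once.\<close>

lemma remove_sings_eq_continuous:
  assumes "open A" "continuous_on A f" "z \<in> A" "\<And>w. w \<in> A - {a} \<Longrightarrow> g w = f w"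
  shows "remove_sings g z = f z"
proof (rule remove_sings_eqI)
  have "\<forall>\<^sub>F w in at z. w \<in> A" "\<forall>\<^sub>F w in at z. w \<noteq> a"
    using assms(1,3) by (auto simp: eventually_neq_at_within intro: eventually_at_in_open')
  then have "\<forall>\<^sub>F w in at z. f w = g w"
    by eventually_elim (use assms(4) in auto)
  moreover have "f \<midarrow>z\<rightarrow> f z"
    using assms(1-3) by (simp add: continuous_on_eq_continuous_at isCont_def)
  ultimately show "g \<midarrow>z\<rightarrow> f z"
    by (simp cong: filterlim_cong add: tendsto_cong)
qed

lemma eta_quot_eq:
  assumes L: "L holomorphic_on ball 0 1" "\<And>z. norm z < 1 \<Longrightarrow> eta M z = z * exp (- L z)"
    and z: "norm z < 1"
  shows "eta_quot M z = exp (L z)"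
  unfolding eta_quot_def
proof (rule remove_sings_eq_continuous[of "ball 0 1" "\<lambda>z. exp (L z)" z 0])
  show "continuous_on (ball 0 1) (\<lambda>z. exp (L z))"
    by (intro continuous_intros holomorphic_on_imp_continuous_on L)
  show "w / eta M w = exp (L w)" if "w \<in> ball 0 1 - {0}" for w
    using that L(2)[of w] by (simp add: exp_minus divide_inverse flip: mult.assoc)
qed (use z in auto)

text \<open>A nonzero derivative makes \<open>eta M\<close> locally invertible, so the choice
  defining \<open>eta_inv\<close> has a witness; all later reasoning about \<open>eta_inv\<close>
  rests on these four facts.\<close>

lemma eta_inv_germ:
  assumes M: "prob_on_circle M" and "first_moment M \<noteq> 0"
  shows "eta_inv M analytic_on {0}" "eta_inv M 0 = 0"
    "\<forall>\<^sub>F z in nhds 0. eta M (eta_inv M z) = z" "\<forall>\<^sub>F z in nhds 0. eta_inv M (eta M z) = z"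
proof -
  have deriv: "deriv (eta M) 0 \<noteq> 0"
    using assms by (simp add: deriv_eta_0)
  have "0 \<in> ball (0::complex) 1" by simp
  then obtain r where r: "r > 0" "ball (0::complex) r \<subseteq> ball 0 1" "open (eta M ` ball 0 r)" "inj_on (eta M) (ball 0 r)"
    by (rule has_complex_derivative_locally_invertible[OF eta_holomorphic[OF M] _ open_ball deriv]) (rule that)
  obtain g where g: "g holomorphic_on eta M ` ball 0 r" "\<And>z. z \<in> ball 0 r \<Longrightarrow> g (eta M z) = z"
    by (rule holomorphic_has_inverse[OF holomorphic_on_subset[OF eta_holomorphic[OF M] r(2)] open_ball r(4)]) (rule that)
  have 0: "0 \<in> ball (0::complex) r" using r(1) by simp
  have img: "0 \<in> eta M ` ball 0 r"
    using imageI[OF 0, of "eta M"] by simp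
  have "g analytic_on {0}"
    using analytic_at r(3) g(1) img by blast
  moreover have "g 0 = 0"
    using g(2)[OF 0] by simp
  moreover have "\<forall>\<^sub>F z in nhds 0. eta M (g z) = z"
    using eventually_nhds_in_open[OF r(3) img] by eventually_elim (auto simp: g(2))
  moreover have "\<forall>\<^sub>F z in nhds 0. g (eta M z) = z"
    using eventually_nhds_in_open[OF open_ball 0] by eventually_elim (rule g(2))
  ultimately have "\<exists>g. g analytic_on {0} \<and> g 0 = 0 \<and>
      (\<forall>\<^sub>F z in nhds 0. eta M (g z) = z) \<and> (\<forall>\<^sub>F z in nhds 0. g (eta M z) = z)"
    by blast
  from someI_ex[OF this]
  show "eta_inv M analytic_on {0}" "eta_inv M 0 = 0"
    "\<forall>\<^sub>F z in nhds 0. eta M (eta_inv M z) = z" "\<forall>\<^sub>F z in nhds 0. eta_inv M (eta M z) = z"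
    unfolding eta_inv_def by blast+
qed

lemma eta_inv_tendsto_0:
  assumes "prob_on_circle M" "first_moment M \<noteq> 0"
  shows "(eta_inv M \<longlongrightarrow> 0) (nhds 0)"
  using analytic_at_imp_isCont[OF eta_inv_germ(1)[OF assms]] eta_inv_germ(2)[OF assms]
  unfolding isCont_def tendsto_at_iff_tendsto_nhds by simp

section \<open>Herglotz representation\<close>

text \<open>Parametrise Cauchy's formula: \<open>cis t - z = cis t * (1 - z * cis (- t))\<close>,
  and the factor \<open>cis t\<close> cancels against the derivative of the path.\<close>

lemma Cauchy_integral_cis:
  fixes f :: "complex \<Rightarrow> complex"
  assumes "f holomorphic_on cball 0 1" "norm z < 1"
  shows "((\<lambda>t. f (cis t) / (1 - z * cis (- t))) has_integral 2 * pi * f z) {0..2*pi}"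
proof -
  have "((\<lambda>u. f u / (u - z)) has_contour_integral 2 * of_real pi * \<i> * f z) (circlepath 0 1)"
    using assms by (intro Cauchy_integral_circlepath_simple) auto
  then have "((\<lambda>t. f (cis t) / (cis t - z) * \<i> * cis t) has_integral 2 * of_real pi * \<i> * f z) {0..2*pi}"
    unfolding circlepath_def
    by (subst (asm) has_contour_integral_part_circlepath_iff) auto
  then have "((\<lambda>t. - \<i> * (f (cis t) / (cis t - z) * \<i> * cis t)) has_integral
      - \<i> * (2 * of_real pi * \<i> * f z)) {0..2*pi}"
    by (rule has_integral_mult_right)
  moreover have "- \<i> * (f (cis t) / (cis t - z) * \<i> * cis t) = f (cis t) / (1 - z * cis (- t))" for t
  proof -
    have "cis t - z = cis t * (1 - z * cis (- t))"
      by (simp add: algebra_simps cis_mult)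
    then have "f (cis t) / (cis t - z) * cis t = f (cis t) / (1 - z * cis (- t))"
      by simp
    moreover have "- \<i> * (a * \<i> * b) = a * b" for a b
      by (simp add: algebra_simps)
    ultimately show ?thesis by simp
  qed
  ultimately show ?thesis by (simp add: mult_ac)
qed

text \<open>
  Write \<open>2 Re F = F + cnj F\<close>. Cauchy's formula at \<open>z\<close> and at \<open>0\<close> gives the part with \<open>F\<close>; the part with
  \<open>cnj F\<close> is the conjugate of a mean value over the circle of a function holomorphic in the disc.
\<close>

lemma Poisson_Herglotz_cis:
  fixes F :: "complex \<Rightarrow> complex"
  assumes F: "F holomorphic_on cball 0 1" "F 0 = 1" and z: "norm z < 1"
  shows "((\<lambda>t. Re (F (cis t)) *\<^sub>R ((1 + z * cis (- t)) / (1 - z * cis (- t)))) has_integral 2 * pi * F z)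
           {0..2*pi}"
proof -
  let ?K = "\<lambda>t. (1 + z * cis (- t)) / (1 - z * cis (- t))"
  have nz: "1 - z * w \<noteq> 0" if "norm w \<le> 1" for w
    using one_minus_mult_nz[OF z that] .
  \<comment> \<open>With \<open>x = z * cis (- t)\<close> the kernel is
    \<open>2 / (1 - x) - 1\<close>.\<close>
  have "((\<lambda>t. 2 * (F (cis t) / (1 - z * cis (- t))) - F (cis t) / (1 - 0 * cis (- t))) has_integral
      2 * (2 * pi * F z) - 2 * pi * F 0) {0..2*pi}"
    by (intro has_integral_diff has_integral_mult_right Cauchy_integral_cis F z) auto
  moreover have "2 * (F (cis t) / (1 - z * cis (- t))) - F (cis t) / (1 - 0 * cis (- t)) = F (cis t) * ?K t" for t
    using nz[of "cis (-t)"] by (simp add: field_simps)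
  ultimately have 1: "((\<lambda>t. F (cis t) * ?K t) has_integral 4 * pi * F z - 2 * pi) {0..2*pi}"
    using F(2) by (simp add: mult.assoc)
  \<comment> \<open>On the circle the conjugate of the kernel is
    \<open>(1 + cnj z * u) / (1 - cnj z * u)\<close>, which is holomorphic in \<open>u\<close> and
    equal to 1 at \<open>u = 0\<close>.\<close>
  let ?G = "\<lambda>u. F u * ((1 + cnj z * u) / (1 - cnj z * u))"
  have "1 - cnj z * u \<noteq> 0" if "norm u \<le> 1" for u
    using nz[of "cnj u"] that by (metis complex_cnj_cancel_iff complex_cnj_cnj complex_cnj_diff complex_cnj_mult complex_cnj_one complex_cnj_zero complex_mod_cnj)
  then have "?G holomorphic_on cball 0 1"
    by (intro holomorphic_intros F) auto
  from Cauchy_integral_cis[OF this, of 0]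
  have "((\<lambda>t. ?G (cis t)) has_integral 2 * pi) {0..2*pi}"
    using F(2) by simp
  then have "((\<lambda>t. cnj (?G (cis t))) has_integral cnj (2 * pi)) {0..2*pi}"
    by (simp only: has_integral_cnj[unfolded o_def])
  then have 2: "((\<lambda>t. cnj (F (cis t)) * ?K t) has_integral 2 * pi) {0..2*pi}"
    by (simp add: cis_cnj)
  have "((\<lambda>t. (F (cis t) * ?K t + cnj (F (cis t)) * ?K t) / 2) has_integral
      (4 * pi * F z - 2 * pi + 2 * pi) / 2) {0..2*pi}"
    by (intro has_integral_divide has_integral_add 1 2)
  moreover have "(a * c + cnj a * c) / 2 = Re a *\<^sub>R c" for a c
    by (simp add: complex_eq_iff)
  moreover have "(4 * pi * F z - 2 * pi + 2 * pi) / 2 = 2 * pi * F z"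
    by simp
  ultimately show ?thesis by (simp only:)
qed

text \<open>The Poisson formula exhibits \<open>Re F / (2 * pi)\<close> as the density. The measure
  is put on the line, over the angles \<open>{0..2*pi}\<close>, so that weak compactness of real
  distributions applies later.\<close>

lemma Herglotz_representation_cball:
  fixes F :: "complex \<Rightarrow> complex"
  assumes F: "F holomorphic_on cball 0 1" "F 0 = 1" and Re_F: "\<And>w. norm w = 1 \<Longrightarrow> 0 \<le> Re (F w)"
  obtains \<mu> :: "real measure"
  where "real_distribution \<mu>" "measure \<mu> {0..2*pi} = 1"
    "\<And>z :: complex. norm z < 1 \<Longrightarrow> (\<integral>t. (1 + z * cis (- t)) / (1 - z * cis (- t)) \<partial>\<mu>) = F z"
proof -
  define d where "d t = indicator {0..2*pi} t * Re (F (cis t)) / (2 * pi)" for t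
  have cont: "continuous_on {0..2*pi} (\<lambda>t. F (cis t))"
    using F(1) by (intro continuous_on_compose2[OF holomorphic_on_imp_continuous_on, of F "cball 0 1"] continuous_intros) auto
  have d_nonneg: "0 \<le> d t" for t
    by (simp add: d_def Re_F)
  define \<mu> where "\<mu> = density lborel (\<lambda>t. ennreal (d t))"
  have d_meas: "d \<in> borel_measurable borel"
  proof -
    have "(\<lambda>t. indicator {0..2*pi} t *\<^sub>R (Re (F (cis t)) / (2 * pi))) \<in> borel_measurable borel"
      using cont by (intro borel_measurable_continuous_on_indicator continuous_intros) auto
    then show ?thesis by (simp add: d_def[abs_def])
  qed
  have int: "(\<integral>t. (1 + z * cis (- t)) / (1 - z * cis (- t)) \<partial>\<mu>) = F z" if z: "norm z < 1" for z :: complex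
  proof -
    let ?K = "\<lambda>t. (1 + z * cis (- t)) / (1 - z * cis (- t))"
    have nz: "1 - z * cis t \<noteq> 0" for t
      using z by (intro one_minus_mult_nz) auto
    have K: "continuous_on A ?K" for A
      using nz by (intro continuous_intros) auto
    have *: "set_integrable lborel {0..2*pi} (\<lambda>t. Re (F (cis t)) *\<^sub>R ?K t)"
      by (intro borel_integrable_atLeastAtMost' continuous_intros cont K)
    have "(\<integral>t. ?K t \<partial>\<mu>) = (\<integral>t. d t *\<^sub>R ?K t \<partial>lborel)"
      unfolding \<mu>_def using d_meas d_nonneg borel_measurable_continuous_onI[OF K]
      by (intro integral_density) auto
    also have "\<dots> = (LINT t : {0..2*pi} | lborel. Re (F (cis t)) *\<^sub>R ?K t) / (2 * pi)"
      unfolding set_lebesgue_integral_def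
      by (subst integral_divide_zero[symmetric]) (auto intro!: Bochner_Integration.integral_cong simp: d_def scaleR_conv_of_real mult_ac)
    also have "\<dots> = integral {0..2*pi} (\<lambda>t. Re (F (cis t)) *\<^sub>R ?K t) / (2 * pi)"
      by (simp only: set_borel_integral_eq_integral(2)[OF *])
    also have "\<dots> = F z"
      using integral_unique[OF Poisson_Herglotz_cis[OF F z]] by simp
    finally show ?thesis .
  qed
  have sets: "sets \<mu> = sets borel" by (simp add: \<mu>_def)
  have mass: "emeasure \<mu> A = 1" if "{0..2*pi} \<subseteq> A" "A \<in> sets borel" for A
  proof -
    have *: "set_integrable lborel {0..2*pi} (\<lambda>t. Re (F (cis t)))"
      by (intro borel_integrable_atLeastAtMost' continuous_intros cont)
    \<comment> \<open>At \<open>z = 0\<close> the kernel is 1, so the Poisson formula gives the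
      total mass \<open>F 0 = 1\<close>.\<close>
    have "((\<lambda>t. Re (Re (F (cis t)) *\<^sub>R ((1 + 0 * cis (- t)) / (1 - 0 * cis (- t))))) has_integral Re (2 * pi * F 0)) {0..2*pi}"
      by (intro has_integral_Re Poisson_Herglotz_cis F) auto
    then have eq: "(LINT t : {0..2*pi} | lborel. Re (F (cis t))) = 2 * pi"
      using F(2) set_borel_integral_eq_integral(2)[OF *] by (simp add: integral_unique)
    have "emeasure \<mu> A = (\<integral>\<^sup>+t. ennreal (d t) * indicator A t \<partial>lborel)"
      unfolding \<mu>_def using d_meas that by (intro emeasure_density) auto
    also have "\<dots> = (\<integral>\<^sup>+t. ennreal (d t) \<partial>lborel)"
      using that by (intro nn_integral_cong) (auto simp: d_def split: split_indicator)
    also have "\<dots> = ennreal (\<integral>t. d t \<partial>lborel)"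
      using * d_nonneg by (intro nn_integral_eq_integral) (auto simp: d_def set_integrable_def)
    also have "(\<integral>t. d t \<partial>lborel) = 1"
      using eq by (simp add: d_def set_lebesgue_integral_def)
    finally show ?thesis by simp
  qed
  have "space \<mu> = UNIV" by (simp add: \<mu>_def)
  have "real_distribution \<mu>"
    using mass[of UNIV] sets
    by (intro real_distribution.intro prob_spaceI real_distribution_axioms.intro) (auto simp: \<open>space \<mu> = UNIV\<close>)
  moreover have "measure \<mu> {0..2*pi} = 1"
    using mass[of "{0..2*pi}"] by (simp add: measure_def)
  ultimately show ?thesis using int that by blast
qed

text \<open>The dilation \<open>F (r n * z)\<close> is holomorphic up to the circle and has a
  representing measure. All these measures sit on one compact interval of angles, so a subsequence
  converges weakly; its limit, moved to the circle, represents \<open>F\<close>.\<close>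

lemma Herglotz_representation:
  fixes F :: "complex \<Rightarrow> complex"
  assumes F: "F holomorphic_on ball 0 1" "F 0 = 1" and Re_F: "\<And>z. norm z < 1 \<Longrightarrow> 0 \<le> Re (F z)"
  obtains \<nu> where "prob_on_circle \<nu>"
    "\<And>z :: complex. norm z < 1 \<Longrightarrow> (\<integral>w. (1 + z * w) / (1 - z * w) \<partial>\<nu>) = F z"
proof -
  define r where "r n = 1 - inverse (real (Suc n))" for n
  have r: "0 \<le> r n" "r n < 1" for n
    by (auto simp: r_def field_simps)
  have r_lim: "r \<longlonglongrightarrow> 1"
    unfolding r_def using tendsto_diff[OF tendsto_const LIMSEQ_inverse_real_of_nat, of 1] by simp
  have r_mult: "norm (r n * z) < 1" if "norm z \<le> 1" for n and z :: complex
    using that r[of n] mult_left_mono[of "norm z" 1 "r n"] by (simp add: norm_mult)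
  have "\<exists>\<mu>. real_distribution \<mu> \<and> measure \<mu> {0..2*pi} = 1 \<and>
      (\<forall>z :: complex. norm z < 1 \<longrightarrow> (\<integral>t. (1 + z * cis (- t)) / (1 - z * cis (- t)) \<partial>\<mu>) = F (r n * z))" for n
  proof (rule Herglotz_representation_cball[of "\<lambda>z. F (r n * z)"])
    show "(\<lambda>z. F (r n * z)) holomorphic_on cball 0 1"
      using r_mult
      by (intro holomorphic_on_compose_gen[OF _ F(1), of "\<lambda>z. r n * z", unfolded o_def] holomorphic_intros) auto
  qed (use F(2) Re_F r_mult in auto)
  then obtain \<mu> where \<mu>: "\<And>n. real_distribution (\<mu> n)" "\<And>n. measure (\<mu> n) {0..2*pi} = 1"
    and int: "\<And>n (z :: complex). norm z < 1 \<Longrightarrow> (\<integral>t. (1 + z * cis (- t)) / (1 - z * cis (- t)) \<partial>\<mu> n) = F (r n * z)"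
    by metis
  interpret \<mu>: real_distribution "\<mu> n" for n by (rule \<mu>)
  have "tight \<mu>"
    unfolding tight_def
  proof (intro conjI allI impI \<mu>(1))
    fix \<epsilon> :: real assume "\<epsilon> > 0"
    \<comment> \<open>Tightness uses intervals open on the left, hence the left end -1: the point 0
      has to stay inside.\<close>
    have "measure (\<mu> n) {0..2*pi} \<le> measure (\<mu> n) {-1<..2*pi}" for n
      by (rule \<mu>.finite_measure_mono) auto
    then have "\<forall>n. measure (\<mu> n) {-1<..2*pi} > 1 - \<epsilon>"
      using \<mu>(2) \<open>\<epsilon> > 0\<close> by (smt (verit))
    moreover have "-1 < 2 * pi" using pi_gt_zero by linarith
    ultimately show "\<exists>a b. a < b \<and> (\<forall>n. measure (\<mu> n) {a<..b} > 1 - \<epsilon>)" by blast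
  qed
  then obtain s \<mu>' where s: "strict_mono (s :: nat \<Rightarrow> nat)" "real_distribution \<mu>'"
    and conv: "weak_conv_m (\<mu> \<circ> id \<circ> s) \<mu>'"
    using tight_imp_convergent_subsubsequence[of \<mu> id] strict_mono_id by blast
  interpret \<mu>': real_distribution \<mu>' by (rule s)
  let ?C = "restrict_space borel (sphere 0 1) :: complex measure"
  let ?e = "\<lambda>t. cis (- t)"
  have e: "?e \<in> \<mu>' \<rightarrow>\<^sub>M ?C"
    unfolding measurable_cong_sets[OF \<mu>'.events_eq_borel refl]
    by (intro measurable_restrict_space2 borel_measurable_continuous_onI continuous_intros) auto
  \<comment> \<open>the orientation of the circle is reversed, since \<open>psi\<close> has \<open>z * w\<close> where the Poisson kernel has \<open>z * cnj w\<close>\<close>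
  define \<nu> where "\<nu> = distr \<mu>' ?C ?e"
  have "prob_on_circle \<nu>"
    unfolding prob_on_circle_def \<nu>_def using \<mu>'.prob_space_distr[OF e] by simp
  moreover have "(\<integral>w. (1 + z * w) / (1 - z * w) \<partial>\<nu>) = F z" if z: "norm z < 1" for z :: complex
  proof -
    let ?K = "\<lambda>w. (1 + z * w) / (1 - z * w)"
    have nz: "1 - z * w \<noteq> 0" if "norm w = 1" for w
      using z that by (intro one_minus_mult_nz) auto
    have K: "continuous_on (sphere 0 1) ?K"
      using nz by (intro continuous_intros) auto
    \<comment> \<open>As \<open>cis (- t)\<close> never leaves the circle, \<open>?K (?e t)\<close>
      is bounded and continuous on the whole line, so it is an admissible test function for weak
      convergence.\<close>
    have Ke: "continuous_on UNIV (\<lambda>t. ?K (?e t))"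
      by (intro continuous_on_compose2[OF K] continuous_intros) auto
    obtain B where B: "\<And>w. w \<in> sphere 0 1 \<Longrightarrow> norm (?K w) \<le> B"
      using continuous_on_compact_bound[OF compact_sphere K] by blast
    have "(\<lambda>n. \<integral>t. ?K (?e t) \<partial>(\<mu> \<circ> id \<circ> s) n) \<longlonglongrightarrow> (\<integral>t. ?K (?e t) \<partial>\<mu>')"
    proof (rule weak_conv_imp_integral_bdd_continuous_conv[OF _ \<mu>'.real_distribution_axioms conv])
      show "isCont (\<lambda>t. ?K (?e t)) t" for t
        using Ke by (simp add: continuous_on_eq_continuous_at)
      show "norm (?K (?e t)) \<le> B" for t
        by (intro B) simp
    qed (simp add: \<mu>(1))
    moreover have "(\<integral>t. ?K (?e t) \<partial>(\<mu> \<circ> id \<circ> s) n) = F (r (s n) * z)" for n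
      using int[OF z] by simp
    moreover have "(\<lambda>n. F (r (s n) * z)) \<longlonglongrightarrow> F (of_real 1 * z)"
    proof (rule isCont_tendsto_compose[where g = F])
      show "isCont F (of_real 1 * z)"
        using z F(1) by (intro continuous_on_interior[OF holomorphic_on_imp_continuous_on]) auto
      show "(\<lambda>n. of_real (r (s n)) * z) \<longlonglongrightarrow> of_real 1 * z"
        using LIMSEQ_subseq_LIMSEQ[OF r_lim s(1)] by (intro tendsto_intros) (simp add: o_def)
    qed
    ultimately have "(\<integral>t. ?K (?e t) \<partial>\<mu>') = F z"
      by (simp add: LIMSEQ_unique)
    moreover have "(\<integral>w. ?K w \<partial>\<nu>) = (\<integral>t. ?K (?e t) \<partial>\<mu>')"
      unfolding \<nu>_def using borel_measurable_continuous_on_restrict[OF K] by (intro integral_distr e)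
    ultimately show ?thesis by simp
  qed
  ultimately show ?thesis using that by blast
qed

text \<open>The Cayley transform \<open>(1 + f) / (1 - f)\<close> has nonnegative real part and
  value 1 at 0. As \<open>(1 + x) / (1 - x) = 1 + 2 * x / (1 - x)\<close>, its Herglotz measure
  satisfies \<open>1 + 2 * psi = (1 + f) / (1 - f)\<close>, that is
  \<open>psi = f / (1 - f)\<close>, and passing to \<open>eta\<close> inverts this.\<close>

lemma eta_eq_self_map:
  assumes f: "f holomorphic_on ball 0 1" "f 0 = 0" and f_less: "\<And>z. norm z < 1 \<Longrightarrow> norm (f z) < 1"
  obtains \<nu> where "prob_on_circle \<nu>" "\<And>z. norm z < 1 \<Longrightarrow> eta \<nu> z = f z"
proof -
  let ?F = "\<lambda>z. (1 + f z) / (1 - f z)"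
  have nz: "1 - f z \<noteq> 0" if "norm z < 1" for z
    using f_less[OF that] by auto
  have "0 \<le> Re (?F z)" if "norm z < 1" for z
  proof -
    have "(norm (f z))\<^sup>2 \<le> 1"
      using f_less[OF that] by (simp add: power_le_one)
    then have "0 \<le> (1 + Re (f z)) * (1 - Re (f z)) - Im (f z) * Im (f z)"
      unfolding cmod_power2 by (simp add: power2_eq_square algebra_simps)
    then show ?thesis by (simp add: Re_divide add_nonneg_nonneg)
  qed
  then obtain \<nu> where \<nu>: "prob_on_circle \<nu>"
    and int: "\<And>z :: complex. norm z < 1 \<Longrightarrow> (\<integral>w. (1 + z * w) / (1 - z * w) \<partial>\<nu>) = ?F z"
    using nz f by (elim Herglotz_representation[rotated 2]) (auto intro!: holomorphic_intros)
  interpret prob_space \<nu> using \<nu> by (simp add: prob_on_circle_def)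
  have "eta \<nu> z = f z" if z: "norm z < 1" for z
  proof -
    have nz_circle: "1 - z * w \<noteq> 0" if "norm w = 1" for w
      using z that by (intro one_minus_mult_nz) auto
    have integrable: "integrable \<nu> (\<lambda>w. z * w / (1 - z * w))"
      using nz_circle by (intro integrable_on_circle[OF \<nu>] continuous_intros) auto
    have "?F z = (\<integral>w. 1 + 2 * (z * w / (1 - z * w)) \<partial>\<nu>)"
      unfolding int[OF z, symmetric] using nz_circle
      by (intro Bochner_Integration.integral_cong) (auto simp: space_prob_on_circle[OF \<nu>] field_simps)
    also have "\<dots> = 1 + 2 * psi \<nu> z"
      using integrable by (simp add: psi_def prob_space del: times_divide_eq_right)
    finally have "psi \<nu> z = (?F z - 1) / 2" by simp
    also have "\<dots> = f z / (1 - f z)"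
      using nz[OF z] by (simp add: divide_simps)
    finally have "psi \<nu> z = f z / (1 - f z)" .
    moreover from this have "1 + psi \<nu> z = 1 / (1 - f z)"
      using nz[OF z] by (simp add: field_simps)
    ultimately show ?thesis
      using nz[OF z] by (simp add: eta_def)
  qed
  with \<nu> show ?thesis using that by blast
qed

section \<open>A fixed point equation in the disc\<close>

text \<open>Schwarz lemma for a zero of order \<open>n\<close>: each induction step divides by
  \<open>z\<close>, and the maximum principle keeps the bound \<open>B\<close>. The estimate with
  \<open>C\<close> encodes the order of the zero, so \<open>C\<close> may be arbitrarily
  large.\<close>

lemma holomorphic_bound_power:
  assumes "h holomorphic_on ball 0 1"
    and "\<And>z. norm z < 1 \<Longrightarrow> norm (h z) \<le> B"
    and "\<And>z. norm z \<le> 1/2 \<Longrightarrow> norm (h z) \<le> C * norm z ^ n"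
    and "norm z < 1"
  shows "norm (h z) \<le> B * norm z ^ n"
  using assms
proof (induction n arbitrary: h z)
  case 0
  then show ?case by simp
next
  case (Suc n)
  have h0: "h 0 = 0" using Suc.prems(3)[of 0] by simp
  obtain g where g: "g holomorphic_on ball 0 1" "\<And>z. norm z < 1 \<Longrightarrow> h z = z * g z"
    using Schwarz3[OF Suc.prems(1) h0] by metis
  have g_bound: "norm (g z) \<le> B" if z: "norm z < 1" for z
  proof -
    \<comment> \<open>On the circle of radius \<open>r\<close>, dividing by \<open>z\<close> costs a
      factor \<open>1 / r\<close>, which disappears as \<open>r\<close> tends to 1.\<close>
    have "norm (g z) \<le> B / r" if r: "norm z < r" "r < 1" for r
    proof (rule maximum_modulus_frontier[where S = "ball 0 r" and f = g])
      have "0 < r" using r norm_ge_zero[of z] by linarith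
      have sub: "cball 0 r \<subseteq> ball (0::complex) 1" using r by auto
      show "g holomorphic_on interior (ball 0 r)"
        using g(1) by (rule holomorphic_on_subset) (use sub in auto)
      show "continuous_on (closure (ball 0 r)) g"
        using g(1) \<open>0 < r\<close> sub
        by (auto intro!: holomorphic_on_imp_continuous_on elim!: holomorphic_on_subset)
      show "norm (g w) \<le> B / r" if "w \<in> frontier (ball 0 r)" for w
      proof -
        have w: "norm w = r" using that \<open>0 < r\<close> by simp
        then have "r * norm (g w) \<le> B"
          using g(2)[of w] Suc.prems(2)[of w] r by (simp add: norm_mult)
        then show ?thesis using \<open>0 < r\<close> by (simp add: field_simps)
      qed
    qed (use r in auto)
    then have "\<forall>\<^sub>F r in at_left 1. norm (g z) \<le> B / r"
      using eventually_at_left_real[OF z] by (auto elim: eventually_mono)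
    moreover have "((\<lambda>r. B / r) \<longlongrightarrow> B / 1) (at_left 1)"
      by (intro tendsto_intros) auto
    ultimately show ?thesis
      using tendsto_lowerbound[of "\<lambda>r. B / r" "B / 1" "at_left 1"] by simp
  qed
  have "norm (g w) \<le> C * norm w ^ n" if w: "norm w \<le> 1/2" for w
  proof -
    have nz: "norm (g w) \<le> C * norm w ^ n" if "w \<noteq> 0" "norm w < 3/4" "norm w \<le> 1/2" for w
      using that g(2)[of w] Suc.prems(3)[of w] by (simp add: norm_mult)
    show ?thesis
    proof (cases "w = 0")
      case True
      \<comment> \<open>The estimate at 0 is the limit of those at nearby points; for positive
        \<open>n\<close> it says \<open>g 0 = 0\<close>.\<close>
      have "\<forall>\<^sub>F w in at 0. norm (g w) \<le> C * norm w ^ n"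
        unfolding eventually_at by (rule exI[of _ "1/2"]) (auto intro: nz)
      moreover have "isCont g 0"
        using g(1) by (intro continuous_on_interior[OF holomorphic_on_imp_continuous_on]) auto
      then have "((\<lambda>w. norm (g w)) \<longlongrightarrow> norm (g 0)) (at 0)"
        unfolding isCont_def by (rule tendsto_norm)
      moreover have "isCont (\<lambda>w :: complex. C * norm w ^ n) 0"
        by (intro continuous_intros)
      ultimately show ?thesis
        using True tendsto_le[of "at (0::complex)"] by (simp add: isCont_def)
    qed (use w nz in auto)
  qed
  then have "norm (g z) \<le> B * norm z ^ n"
    using Suc.IH[OF g(1) g_bound] Suc.prems(4) by blast
  then have "norm z * norm (g z) \<le> norm z * (B * norm z ^ n)"
    by (intro mult_left_mono) auto
  then show ?case
    using g(2)[OF Suc.prems(4)] by (simp add: norm_mult mult_ac)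
qed

text \<open>
  The iterates of \<open>v \<mapsto> z k(v)\<close> started at 0 agree to order \<open>n\<close> at the origin. As they map the disc
  to itself, the Schwarz lemma turns this into a geometric bound on the whole disc.
\<close>

lemma holomorphic_fixed_point:
  assumes k: "k holomorphic_on ball 0 1" and k_le: "\<And>w. norm w < 1 \<Longrightarrow> norm (k w) \<le> 1"
  obtains \<omega> where "\<omega> holomorphic_on ball 0 1"
    "\<And>z. norm z < 1 \<Longrightarrow> norm (\<omega> z) \<le> norm z"
    "\<And>z. norm z < 1 \<Longrightarrow> \<omega> z = z * k (\<omega> z)"
proof -
  define v where "v n = ((\<lambda>f z. z * k (f z)) ^^ n) (\<lambda>_. 0)" for n :: nat
  have v_0 [simp]: "v 0 z = 0" and v_Suc: "v (Suc n) z = z * k (v n z)" for n z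
    by (simp_all add: v_def)
  have v_le: "norm (v n z) \<le> norm z" if z: "norm z < 1" for n z
  proof (induction n)
    case (Suc n)
    have "norm z * norm (k (v n z)) \<le> norm z * 1"
      using Suc z by (intro mult_left_mono k_le) auto
    then show ?case by (simp add: v_Suc norm_mult)
  qed simp
  have v_holo: "v n holomorphic_on ball 0 1" for n
  proof (induction n)
    case (Suc n)
    have "(\<lambda>z. k (v n z)) holomorphic_on ball 0 1"
      using v_le by (intro holomorphic_on_compose_gen[OF Suc k, unfolded o_def]) (fastforce intro: le_less_trans)
    then show ?case
      unfolding v_Suc by (intro holomorphic_intros)
  qed (simp add: v_def)
  \<comment> \<open>For \<open>norm z \<le> 1/2\<close> the iterates stay in this smaller closed
    ball, where \<open>k\<close> is Lipschitz; \<open>K\<close> may exceed 1.\<close>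
  obtain K where K: "\<And>x y. norm x \<le> 1/2 \<Longrightarrow> norm y \<le> 1/2 \<Longrightarrow> norm (k x - k y) \<le> K * norm (x - y)"
    and "K \<ge> 0"
  proof -
    have sub: "cball 0 (1/2) \<subseteq> ball (0::complex) 1" by auto
    have "continuous_on (cball 0 (1/2)) (deriv k)"
      using sub holomorphic_deriv[OF k open_ball]
      by (meson holomorphic_on_imp_continuous_on holomorphic_on_subset)
    then obtain K where "K \<ge> 0" and K: "\<And>x. x \<in> cball 0 (1/2) \<Longrightarrow> norm (deriv k x) \<le> K"
      using continuous_on_compact_bound[OF compact_cball] by blast
    have "norm (k x - k y) \<le> K * norm (x - y)" if "norm x \<le> 1/2" "norm y \<le> 1/2" for x y
    proof (rule field_differentiable_bound[of "cball 0 (1/2)"])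
      show "(k has_field_derivative deriv k x) (at x within cball 0 (1/2))"
        if "x \<in> cball 0 (1/2)" for x
        using that sub holomorphic_derivI[OF k open_ball] by blast
    qed (use that K in auto)
    with \<open>K \<ge> 0\<close> show ?thesis using that by blast
  qed
  have local: "norm (v (Suc n) z - v n z) \<le> K ^ n * norm z ^ Suc n" if z: "norm z \<le> 1/2" for n z
  proof (induction n)
    case 0
    show ?case using v_le[of z 1] z by simp
  next
    case (Suc n)
    have "norm (v n z) \<le> 1/2" for n using v_le[of z n] z by linarith
    then have "norm (k (v (Suc n) z) - k (v n z)) \<le> K * norm (v (Suc n) z - v n z)"
      by (intro K)
    also have "\<dots> \<le> K * (K ^ n * norm z ^ Suc n)"
      using Suc \<open>K \<ge> 0\<close> by (rule mult_left_mono)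
    finally have "norm z * norm (k (v (Suc n) z) - k (v n z)) \<le> norm z * (K * (K ^ n * norm z ^ Suc n))"
      by (rule mult_left_mono) simp
    then show ?case
      by (simp add: v_Suc norm_mult mult_ac flip: right_diff_distrib)
  qed
  \<comment> \<open>Since \<open>K ^ n\<close> may grow, \<open>local\<close> only supplies a zero
    of order \<open>Suc n\<close>; the constant 2 bounds the difference of two maps into the
    disc.\<close>
  have step: "norm (v (Suc n) z - v n z) \<le> 2 * norm z ^ Suc n" if z: "norm z < 1" for n z
  proof (rule holomorphic_bound_power[of "\<lambda>z. v (Suc n) z - v n z"])
    show "(\<lambda>z. v (Suc n) z - v n z) holomorphic_on ball 0 1"
      by (intro holomorphic_intros v_holo)
    show "norm (v (Suc n) z - v n z) \<le> 2" if "norm z < 1" for z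
      using norm_triangle_ineq4[of "v (Suc n) z" "v n z"] v_le[OF that, of n] v_le[OF that, of "Suc n"] that
      by linarith
  qed (use local z in auto)
  have ex_ulim: "\<exists>\<omega>. uniform_limit (cball 0 r) v \<omega> sequentially" if r: "r < 1" for r
  proof -
    have "uniform_limit (cball 0 r) (\<lambda>n z. \<Sum>i<n. v (Suc i) z - v i z)
            (\<lambda>z. \<Sum>i. v (Suc i) z - v i z) sequentially"
    proof (rule Weierstrass_m_test)
      \<comment> \<open>\<open>max 0 r\<close> keeps the majorant nonnegative and summable also for
        negative \<open>r\<close>, where the ball is empty.\<close>
      show "norm (v (Suc n) z - v n z) \<le> 2 * max 0 r ^ Suc n" if "z \<in> cball 0 r" for n z
      proof -
        have "norm z \<le> max 0 r" "norm z < 1" using that r by auto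
        then have "norm z ^ Suc n \<le> max 0 r ^ Suc n" by (intro power_mono) auto
        then show ?thesis using step[OF \<open>norm z < 1\<close>, of n] by linarith
      qed
      show "summable (\<lambda>n. 2 * max 0 r ^ Suc n)"
      proof -
        have "summable (\<lambda>n. max 0 r ^ n)"
          using r by (intro summable_geometric) auto
        then show ?thesis
          by (simp only: summable_Suc_iff summable_mult)
      qed
    qed
    moreover have "(\<Sum>i<n. v (Suc i) z - v i z) = v n z" for n z
      using sum_lessThan_telescope[of "\<lambda>i. v i z" n] by simp
    ultimately show ?thesis by auto
  qed
  have conv: "\<exists>l. (\<lambda>n. v n z) \<longlonglongrightarrow> l" if z: "norm z < 1" for z
  proof -
    obtain l where "uniform_limit (cball 0 (norm z)) v l sequentially"
      using ex_ulim[OF z] by blast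
    from tendsto_uniform_limitI[OF this, of z] show ?thesis by auto
  qed
  \<comment> \<open>The uniform limits on different balls all agree with this pointwise limit, so
    they glue to one function on the disc.\<close>
  define \<omega> where "\<omega> z = lim (\<lambda>n. v n z)" for z
  have lim: "(\<lambda>n. v n z) \<longlonglongrightarrow> \<omega> z" if "norm z < 1" for z
    using conv[OF that] by (simp add: \<omega>_def convergent_def flip: convergent_LIMSEQ_iff)
  have ulim: "uniform_limit (cball 0 r) v \<omega> sequentially" if r: "r < 1" for r
  proof -
    obtain l where l: "uniform_limit (cball 0 r) v l sequentially"
      using ex_ulim[OF r] by blast
    have "l z = \<omega> z" if z: "z \<in> cball 0 r" for z
      using LIMSEQ_unique[OF tendsto_uniform_limitI[OF l z] lim] z r by simp
    then show ?thesis
      using l uniform_limit_cong'[of "cball 0 r" v v l \<omega> sequentially] by simp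
  qed
  show ?thesis
  proof
    show "\<omega> holomorphic_on ball 0 1"
    proof (rule holomorphic_uniform_sequence[OF open_ball v_holo])
      fix x :: complex assume x: "x \<in> ball 0 1"
      let ?d = "(1 - norm x) / 2"
      have "cball x ?d \<subseteq> cball 0 (norm x + ?d)"
        by (rule cball_subset_cball_iff[THEN iffD2]) simp
      moreover have "norm x + ?d < 1" using x by (simp add: field_simps)
      ultimately have "uniform_limit (cball x ?d) v \<omega> sequentially" "cball x ?d \<subseteq> ball 0 1"
        using uniform_limit_on_subset[OF ulim] by fastforce+
      moreover have "?d > 0" using x by simp
      ultimately show "\<exists>d>0. cball x d \<subseteq> ball 0 1 \<and> uniform_limit (cball x d) v \<omega> sequentially"
        by blast
    qed
    show le: "norm (\<omega> z) \<le> norm z" if "norm z < 1" for z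
      using tendsto_norm[OF lim[OF that]] v_le[OF that] by (intro Lim_bounded) auto
    show "\<omega> z = z * k (\<omega> z)" if z: "norm z < 1" for z
    proof -
      have "isCont k (\<omega> z)"
        using k le[OF z] z by (intro continuous_on_interior[OF holomorphic_on_imp_continuous_on]) auto
      then have "(\<lambda>n. z * k (v n z)) \<longlonglongrightarrow> z * k (\<omega> z)"
        by (intro tendsto_mult tendsto_const isCont_tendsto_compose[OF _ lim[OF z]])
      moreover have "(\<lambda>n. v (Suc n) z) \<longlonglongrightarrow> \<omega> z"
        using lim[OF z] by (rule LIMSEQ_Suc)
      ultimately show ?thesis
        by (simp add: v_Suc LIMSEQ_unique)
    qed
  qed
qed

section \<open>Convolution powers\<close>

theorem theorem2p10:
  fixes M :: "complex measure" and t :: real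
  assumes "prob_on_circle M"
    and "first_moment M \<noteq> 0"
    and "t > 1"
    and "eta_zero_free M"
  shows "\<exists>L Mt \<omega> Lt.
    log_branch (ball 0 1) (eta_quot M) L \<and>
    (prob_on_circle Mt \<and> first_moment Mt \<noteq> 0 \<and>
     (\<exists>r>0. \<exists>LS. log_branch (ball 0 r) (Sigma_transform M) LS \<and>
        (\<forall>z\<in>ball 0 r. LS z = L (eta_inv M z)) \<and>
        (\<forall>z\<in>ball 0 r. Sigma_transform Mt z = branch_power LS t z)) \<and>
     eta_zero_free Mt) \<and>
    (\<omega> holomorphic_on ball 0 1 \<and> \<omega> ` ball 0 1 \<subseteq> ball 0 1 \<and>
     (\<forall>z\<in>ball 0 1. norm (\<omega> z) \<le> norm z \<and> eta Mt z = eta M (\<omega> z))) \<and>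
    (log_branch (ball 0 1) (eta_quot Mt) Lt \<and>
     (\<forall>z\<in>ball 0 1. \<omega> z = eta Mt z * branch_power Lt (1 / t) z \<and> Phi L t (\<omega> z) = z))"
proof -
  note M = assms(1) and fm = assms(2) and t = assms(3)

  \<comment> \<open>The logarithm of \<open>z / eta M z\<close>\<close>
  obtain H where H: "H holomorphic_on ball 0 1" "H 0 = first_moment M"
    and eta_H: "\<And>z. norm z < 1 \<Longrightarrow> eta M z = z * H z"
    using eta_factor[OF M] by metis
  have H_nz: "H z \<noteq> 0" if "z \<in> ball 0 1" for z
    using that H(2) fm assms(4) eta_H[of z] by (cases "z = 0") (auto simp: eta_zero_free_def)
  have "(\<lambda>z. inverse (H z)) holomorphic_on ball 0 1"
    using H_nz by (intro holomorphic_intros H(1)) auto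
  moreover have "inverse (H z) \<noteq> 0" if "z \<in> ball 0 1" for z
    using H_nz[OF that] by simp
  ultimately obtain L where L: "L holomorphic_on ball 0 1"
    and "\<And>z. z \<in> ball 0 1 \<Longrightarrow> exp (L z) = inverse (H z)"
    using holomorphic_logarithm_exists[OF convex_ball open_ball, of "\<lambda>z. inverse (H z)" 0 1 0]
    by (metis centre_in_ball zero_less_one)
  then have H_exp: "H z = exp (- L z)" if "norm z < 1" for z
    using that by (simp add: exp_minus)
  have eta_L: "eta M z = z * exp (- L z)" if "norm z < 1" for z
    using eta_H H_exp that by simp

  \<comment> \<open>The subordination function \<open>\<omega>\<close>\<close>
  define k where "k z = exp (- (of_real (t - 1) * L z))" for z
  have "norm (k z) \<le> 1" if "norm z < 1" for z
  proof -
    have "Re (L z) \<ge> 0"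
      using norm_factor_le_1[OF M H(1) eta_H that] H_exp[OF that] by simp
    then show ?thesis using t by (simp add: k_def)
  qed
  moreover have "k holomorphic_on ball 0 1"
    unfolding k_def by (intro holomorphic_intros L)
  ultimately obtain \<omega> where \<omega>: "\<omega> holomorphic_on ball 0 1"
    and \<omega>_le: "\<And>z. norm z < 1 \<Longrightarrow> norm (\<omega> z) \<le> norm z"
    and \<omega>_fix: "\<And>z. norm z < 1 \<Longrightarrow> \<omega> z = z * k (\<omega> z)"
    using holomorphic_fixed_point by metis
  have \<omega>_less: "norm (\<omega> z) < 1" if "norm z < 1" for z
    using \<omega>_le[OF that] that by linarith
  have \<omega>_0: "\<omega> 0 = 0" using \<omega>_le[of 0] by simp
  have comp: "(\<lambda>z. f (\<omega> z)) holomorphic_on ball 0 1" if "f holomorphic_on ball 0 1" for f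
    using \<omega>_less by (intro holomorphic_on_compose_gen[OF \<omega> that, unfolded o_def]) auto
  have Phi_\<omega>: "\<omega> z * exp (of_real (t - 1) * L (\<omega> z)) = z" if "norm z < 1" for z
  proof -
    have "\<omega> z * exp (of_real (t - 1) * L (\<omega> z)) = z * (k (\<omega> z) * exp (of_real (t - 1) * L (\<omega> z)))"
      using \<omega>_fix[OF that] by (metis mult.assoc)
    then show ?thesis by (simp add: k_def flip: exp_add)
  qed

  \<comment> \<open>The measure \<open>Mt\<close> and the logarithm of its quotient\<close>
  obtain Mt where Mt: "prob_on_circle Mt" and eta_Mt: "\<And>z. norm z < 1 \<Longrightarrow> eta Mt z = eta M (\<omega> z)"
    using eta_eq_self_map[OF comp[OF eta_holomorphic[OF M]]] \<omega>_0 norm_eta_less_1[OF M] \<omega>_less by auto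
  \<comment> \<open>From \<open>eta Mt z = \<omega> z * exp (- L (\<omega> z))\<close> and
    \<open>z = \<omega> z * exp ((t - 1) * L (\<omega> z))\<close> the quotient
    \<open>z / eta Mt z\<close> is \<open>exp (t * L (\<omega> z))\<close>. With this logarithm the
    power \<open>1 / t\<close> is exactly \<open>exp (L (\<omega> z))\<close>.\<close>
  define Lt where "Lt z = of_real t * L (\<omega> z)" for z
  have Lt: "Lt holomorphic_on ball 0 1"
    unfolding Lt_def by (intro holomorphic_intros comp L)
  have eta_Lt: "eta Mt z = z * exp (- Lt z)" if "norm z < 1" for z
  proof -
    have "eta Mt z = \<omega> z * exp (- L (\<omega> z))"
      using eta_Mt[OF that] eta_L[OF \<omega>_less[OF that]] by simp
    also have "\<dots> = z * (k (\<omega> z) * exp (- L (\<omega> z)))"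
      using \<omega>_fix[OF that] by (metis mult.assoc)
    also have "k (\<omega> z) * exp (- L (\<omega> z)) = exp (- Lt z)"
      by (simp add: k_def Lt_def algebra_simps flip: exp_add)
    finally show ?thesis .
  qed
  \<comment> \<open>The first moment is the value at 0 of the factor \<open>exp (- Lt z)\<close>,
    which has no zero.\<close>
  have fmt: "first_moment Mt \<noteq> 0"
    using first_moment_eq_factor[OF Mt holomorphic_on_exp'[OF holomorphic_on_minus[OF Lt]] eta_Lt] by simp
  have "eta_zero_free Mt"
    by (simp add: eta_zero_free_def eta_Lt)
  have \<omega>_eq: "\<omega> z = eta Mt z * branch_power Lt (1 / t) z" if "norm z < 1" for z
  proof -
    have "branch_power Lt (1 / t) z = exp (L (\<omega> z))"
      using t by (simp add: branch_power_def Lt_def)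
    then show ?thesis
      using eta_Mt[OF that] eta_L[OF \<omega>_less[OF that]] by (simp add: exp_minus)
  qed

  \<comment> \<open>The Sigma transforms near the origin\<close>
  let ?g = "eta_inv M" and ?gt = "eta_inv Mt"
  note g = eta_inv_germ[OF M fm] and gt = eta_inv_germ[OF Mt fmt]
  note g_tendsto = eta_inv_tendsto_0[OF M fm] and gt_tendsto = eta_inv_tendsto_0[OF Mt fmt]
  have unit: "\<forall>\<^sub>F z in nhds 0. norm (z :: complex) < 1"
    using eventually_nhds_in_open[of "ball (0::complex) 1" 0] by simp
  have "isCont \<omega> 0"
    using \<omega> by (intro continuous_on_interior[OF holomorphic_on_imp_continuous_on]) auto
  then have "filterlim \<omega> (nhds 0) (nhds 0)"
    unfolding isCont_def tendsto_at_iff_tendsto_nhds by (simp add: \<omega>_0)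
  then have "filterlim (\<lambda>z. \<omega> (?gt z)) (nhds 0) (nhds 0)"
    using gt_tendsto by (rule filterlim_compose)
  \<comment> \<open>As \<open>eta M (\<omega> (?gt z)) = z\<close> near 0, this identifies
    \<open>\<omega> (?gt z)\<close> with \<open>?g z\<close>. The left inverse property holds only
    near 0, hence the preceding limits.\<close>
  then have ev: "\<forall>\<^sub>F z in nhds 0. ?g (eta M (\<omega> (?gt z))) = \<omega> (?gt z)"
    using g(4) by (rule eventually_compose_filterlim[rotated])
  obtain A where A: "open A" "0 \<in> A" "?g holomorphic_on A"
    using g(1) by (auto simp: analytic_at)
  have "\<forall>\<^sub>F z in nhds 0. z \<in> A \<and> norm (?g z) < 1 \<and> norm (?gt z) < 1 \<and> eta M (?g z) = z \<and>
      eta Mt (?gt z) = z \<and> ?g (eta M (\<omega> (?gt z))) = \<omega> (?gt z)"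
    using eventually_nhds_in_open[OF A(1,2)] eventually_compose_filterlim[OF unit g_tendsto]
      eventually_compose_filterlim[OF unit gt_tendsto] g(3) gt(3) ev
    by eventually_elim auto
  then obtain r where r: "r > 0" and near: "\<And>z. norm z < r \<Longrightarrow> z \<in> A \<and> norm (?g z) < 1 \<and>
      norm (?gt z) < 1 \<and> eta M (?g z) = z \<and> eta Mt (?gt z) = z \<and>
      ?g (eta M (\<omega> (?gt z))) = \<omega> (?gt z)"
    unfolding eventually_nhds_metric by (auto simp: dist_norm)
  \<comment> \<open>Putting \<open>?g z\<close> into \<open>eta M w = w * exp (- L w)\<close> gives
    \<open>?g z = z * exp (L (?g z))\<close>, so this is a logarithm of
    \<open>Sigma_transform M\<close>.\<close>
  define LS where "LS z = L (?g z)" for z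
  have LS: "LS holomorphic_on ball 0 r"
    unfolding LS_def using near
    by (intro holomorphic_on_compose_gen[OF holomorphic_on_subset[OF A(3)] L, unfolded o_def]) auto
  have g_LS: "?g z = z * exp (LS z)" if "norm z < r" for z
    using near[OF that] eta_L[of "?g z"] by (metis LS_def exp_minus_inverse mult.assoc mult.commute mult.right_neutral)
  have gt_LS: "?gt z = z * exp (of_real t * LS z)" if z: "norm z < r" for z
  proof -
    have "\<omega> (?gt z) = ?g z"
      using near[OF z] eta_Mt[of "?gt z"] by simp
    \<comment> \<open>This is \<open>Phi L t (\<omega> w) = w\<close> at
      \<open>w = ?gt z\<close>.\<close>
    then have "?gt z = ?g z * exp (of_real (t - 1) * LS z)"
      using Phi_\<omega>[of "?gt z"] near[OF z] by (simp add: LS_def)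
    also have "\<dots> = z * (exp (LS z) * exp (of_real (t - 1) * LS z))"
      using g_LS[OF z] by simp
    also have "exp (LS z) * exp (of_real (t - 1) * LS z) = exp (of_real t * LS z)"
      by (simp add: algebra_simps flip: exp_add)
    finally show ?thesis .
  qed
  \<comment> \<open>A general \<open>c\<close> serves both \<open>M\<close>, with
    \<open>c = 1\<close>, and \<open>Mt\<close>, with \<open>c = t\<close>.\<close>
  have Sigma: "Sigma_transform N z = exp (c * LS z)"
    if "norm z < r" "\<And>w. norm w < r \<Longrightarrow> eta_inv N w = w * exp (c * LS w)" for N z c
    unfolding Sigma_transform_def
  proof (rule remove_sings_eq_continuous[of "ball 0 r" "\<lambda>z. exp (c * LS z)" z 0])
    show "continuous_on (ball 0 r) (\<lambda>z. exp (c * LS z))"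
      by (intro continuous_intros holomorphic_on_imp_continuous_on LS)
  qed (use that in auto)

  have branches: "log_branch (ball 0 1) (eta_quot M) L" "log_branch (ball 0 1) (eta_quot Mt) Lt"
    using L Lt eta_quot_eq[OF L eta_L] eta_quot_eq[OF Lt eta_Lt] by (auto simp: log_branch_def)
  have "log_branch (ball 0 r) (Sigma_transform M) LS"
    using LS Sigma[of _ M 1] g_LS by (auto simp: log_branch_def)
  moreover have "\<forall>z\<in>ball 0 r. Sigma_transform Mt z = branch_power LS t z"
    unfolding branch_power_def using gt_LS Sigma[of _ Mt "of_real t"] by simp
  ultimately have "\<exists>r>0. \<exists>LS. log_branch (ball 0 r) (Sigma_transform M) LS \<and>
      (\<forall>z\<in>ball 0 r. LS z = L (eta_inv M z)) \<and>
      (\<forall>z\<in>ball 0 r. Sigma_transform Mt z = branch_power LS t z)"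
    using r LS_def by blast
  moreover have "\<omega> ` ball 0 1 \<subseteq> ball 0 1"
    using \<omega>_less by auto
  moreover have "\<forall>z\<in>ball 0 1. norm (\<omega> z) \<le> norm z \<and> eta Mt z = eta M (\<omega> z)"
    using \<omega>_le eta_Mt by simp
  moreover have "\<forall>z\<in>ball 0 1. \<omega> z = eta Mt z * branch_power Lt (1 / t) z \<and> Phi L t (\<omega> z) = z"
    using \<omega>_eq Phi_\<omega> by (simp add: Phi_def branch_power_def)
  ultimately show ?thesis
    using branches Mt fmt \<open>eta_zero_free Mt\<close> \<omega> by blast
qed

end
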